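(* For real $t\to+\infty$ we have $$\mathcal{R}(\tfrac12-it)=-\frac{1}{\sqrt2}\Bigl(\frac{t}{2\pi}\Bigr)^{-\frac14}\exp\Bigl\{\frac{\pi t}{2}-\Bigl(\frac{\pi t}{2}\Bigr)^{\frac12}\Bigr\}\cdot\exp\Bigl\{i\Bigl(\frac{t}{2}\log\frac{t}{2\pi}-\frac{t}{2}+\frac{3\pi}{8}\Bigr)\Bigr\}\cdot\bigl(1+O(t^{-\frac12})\bigr).$$
   Context: Riemann's auxiliary function is the entire function $$\mathcal{R}(s)=\int_{0\swarrow1}\frac{x^{-s}e^{\pi i x^2}}{e^{\pi i x}-e^{-\pi i x}}\,dx,$$ where the path is a straight line of direction $e^{-3\pi i/4}$ (running from the upper right to the lower left) crossing the real axis at a point strictly between $0$ and $1$, and $x^{-s}=\exp(-s\log x)$ with the principal logarithm. *)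

theory Defs
  imports "HOL-Complex_Analysis.Complex_Analysis" "HOL-Library.Landau_Symbols"
begin

definition riemann_aux_integrand :: "complex \<Rightarrow> complex \<Rightarrow> complex" where
  "riemann_aux_integrand s x =
     x powr (-s) * exp (of_real pi * \<i> * x\<^sup>2)
       / (exp (of_real pi * \<i> * x) - exp (- (of_real pi * \<i> * x)))"

(* The line is parametrised by u |-> c + u * cis (-3 pi / 4), with u increasing over the reals;
   the trailing factor is its derivative. For 0 < c < 1 the line meets neither the integers nor
   the branch cut of the logarithm, and the integrand has Gaussian decay along it, so the
   Lebesgue integral exists. By Cauchy's theorem its value does not depend on c in (0,1). *)
definition riemann_aux :: "real \<Rightarrow> complex \<Rightarrow> complex" where
  "riemann_aux c s =
     (LBINT u. riemann_aux_integrand s (of_real c + of_real u * cis (- (3 * pi / 4)))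
                 * cis (- (3 * pi / 4)))"

end

theory Submission
  imports Defs "HOL-Probability.Probability" "HOL-Real_Asymp.Real_Asymp"
begin

text \<open>
  Put \<open>a = sqrt (t / (2 * pi))\<close>. On the part of the path with \<open>arg x \<ge> - pi / 4\<close> the factor
  \<open>x powr (\<i> * t)\<close> is at most \<open>exp (pi * t / 4)\<close>, which is negligible against \<open>exp (pi * t / 2)\<close>.
  The rest of the path lies in the open lower half plane, where the integrand is holomorphic.
  There it is shifted horizontally, without crossing a pole, onto the parallel line through the
  saddle point \<open>- \<i> * a\<close>; the cost is an integral over a horizontal segment of length below \<open>a\<close>,
  which is \<open>exp (pi * t / 4 + O (sqrt t))\<close>.
  On the new line write \<open>x = - \<i> * a * (1 + z)\<close> with \<open>z = (y / a) * (\<i> - 1)\<close>. The logarithm of the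
  integrand differs from its quadratic expansion by \<open>O ((\<bar>y\<bar>^3 + \<bar>y\<bar>) / a)\<close>, and both are dominated
  by a fixed Gaussian, uniformly on the whole ray and not merely near the saddle. Hence the
  integral differs from a complex Gaussian integral by a relative error \<open>O (1 / a)\<close>.
\<close>

section \<open>Gaussian integrals\<close>

text \<open>Completing the square exhibits the function as a constant multiple of the normal density
  with mean \<open>\<beta> / (2 * \<alpha>)\<close> and variance
  \<open>1 / (2 * \<alpha>)\<close>.\<close>

lemma integrable_exp_quadratic:
  fixes \<alpha> \<beta> :: real
  assumes "\<alpha> > 0"
  shows "integrable lborel (\<lambda>x. exp (- \<alpha> * x\<^sup>2 + \<beta> * x))"
proof -
  define \<sigma> where "\<sigma> = sqrt (1 / (2 * \<alpha>))"
  have s: "\<sigma>\<^sup>2 = 1 / (2 * \<alpha>)" "\<sigma> > 0" using assms by (auto simp: \<sigma>_def)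
  have e: "exp (- \<alpha> * x\<^sup>2 + \<beta> * x) =
      (sqrt (2 * pi * \<sigma>\<^sup>2) * exp (\<beta>\<^sup>2 / (4 * \<alpha>))) * normal_density (\<beta> / (2 * \<alpha>)) \<sigma> x" for x
  proof -
    have "- \<alpha> * x\<^sup>2 + \<beta> * x = \<beta>\<^sup>2 / (4 * \<alpha>) + - (x - \<beta> / (2 * \<alpha>))\<^sup>2 / (2 * \<sigma>\<^sup>2)"
      using assms unfolding s by (simp add: field_simps power2_eq_square)
    moreover have "sqrt (2 * pi * \<sigma>\<^sup>2) \<noteq> 0" using s assms by simp
    ultimately show ?thesis unfolding normal_density_def by (simp only: exp_add) simp
  qed
  show ?thesis unfolding e using s assms by (intro integrable_mult_right) auto
qed

lemma integrable_cexp_quadratic: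
  fixes \<beta> :: complex
  assumes "\<alpha> > 0"
  shows "integrable lborel (\<lambda>x::real. exp (- of_real \<alpha> * of_real x ^ 2 + \<beta> * of_real x))"
proof (rule Bochner_Integration.integrable_bound[OF integrable_exp_quadratic[OF assms, of "Re \<beta>"]])
  show "(\<lambda>x::real. exp (- of_real \<alpha> * of_real x ^ 2 + \<beta> * of_real x)) \<in> borel_measurable lborel"
    by (simp add: borel_measurable_continuous_onI continuous_intros)
  have "Re (- of_real \<alpha> * of_real x ^ 2 + \<beta> * of_real x) = - \<alpha> * x\<^sup>2 + Re \<beta> * x" for x
    by (simp flip: of_real_power)
  then show "AE x in lborel. norm (exp (- of_real \<alpha> * of_real x ^ 2 + \<beta> * of_real x))
      \<le> norm (exp (- \<alpha> * x\<^sup>2 + Re \<beta> * x))"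
    by (simp add: norm_exp_eq_Re)
qed

text \<open>The value comes from the characteristic function of the standard normal law: the
  substitution \<open>x = m + \<sigma> * w\<close> absorbs \<open>Re \<beta>\<close> by recentring,
  and \<open>Im \<beta>\<close> becomes the frequency \<open>\<tau>\<close>.\<close>

lemma integral_cexp_quadratic:
  fixes \<beta> :: complex
  assumes "\<alpha> > 0"
  shows "(LBINT x. exp (- of_real \<alpha> * of_real x ^ 2 + \<beta> * of_real x)) =
    of_real (sqrt (pi / \<alpha>)) * exp (\<beta>\<^sup>2 / (4 * of_real \<alpha>))"
proof -
  define \<sigma> where "\<sigma> = sqrt (1 / (2 * \<alpha>))"
  have s: "\<sigma>\<^sup>2 = 1 / (2 * \<alpha>)" "\<sigma> > 0" using assms by (auto simp: \<sigma>_def)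
  define m where "m = Re \<beta> / (2 * \<alpha>)"
  define \<tau> where "\<tau> = \<sigma> * Im \<beta>"
  \<comment> \<open>\<open>\<gamma>\<close> is the value of the exponent at the centre
    \<open>m\<close>.\<close>
  define \<gamma> where "\<gamma> = \<beta> * of_real m - of_real \<alpha> * of_real (m\<^sup>2)"
  have "char std_normal_distribution \<tau> = exp (- (of_real \<tau>)\<^sup>2 / 2)"
    using fun_cong[OF char_std_normal_distribution, of \<tau>] by (simp flip: of_real_power exp_of_real)
  also have "char std_normal_distribution \<tau> = (LBINT w. std_normal_density w *\<^sub>R exp (\<i> * of_real (\<tau> * w)))"
    unfolding char_def by (subst integral_density) auto
  finally have ch: "(LBINT w. std_normal_density w *\<^sub>R exp (\<i> * of_real (\<tau> * w))) = exp (- (of_real \<tau>)\<^sup>2 / 2)" .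
  have *: "exp (- of_real \<alpha> * of_real (m + \<sigma> * w) ^ 2 + \<beta> * of_real (m + \<sigma> * w)) =
     (of_real (sqrt (2 * pi)) * exp \<gamma>) * (std_normal_density w *\<^sub>R exp (\<i> * of_real (\<tau> * w)))" for w
  proof -
    have sc: "of_real \<sigma> ^ 2 = (1 / (2 * of_real \<alpha>) :: complex)"
      using s(1) by (simp flip: of_real_power)
    have "- of_real \<alpha> * of_real (m + \<sigma> * w) ^ 2 + \<beta> * of_real (m + \<sigma> * w) = 
      \<gamma> + of_real (- w\<^sup>2 / 2) + \<i> * of_real (\<tau> * w)"
    proof -
      have 1: "of_real \<alpha> * of_real (m + \<sigma> * w) ^ 2 = complex_of_real (\<alpha> * m\<^sup>2 + 2 * \<alpha> * m * \<sigma> * w + w\<^sup>2 / 2)"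
      proof -
        have "\<alpha> * (m + \<sigma> * w) ^ 2 = \<alpha> * m\<^sup>2 + 2 * \<alpha> * m * \<sigma> * w + \<alpha> * \<sigma>\<^sup>2 * w\<^sup>2"
          by (simp add: algebra_simps power2_eq_square)
        also have "\<alpha> * \<sigma>\<^sup>2 * w\<^sup>2 = w\<^sup>2 / 2" using assms s by simp
        finally show ?thesis by (simp only: flip: of_real_power of_real_mult)
      qed
      have 2: "2 * \<alpha> * m = Re \<beta>" using assms by (simp add: m_def)
      show ?thesis unfolding mult_minus_left 1 2
        by (simp add: complex_eq_iff \<gamma>_def \<tau>_def algebra_simps flip: of_real_power)
    qed
    moreover have "exp (complex_of_real (- w\<^sup>2 / 2)) = of_real (sqrt (2 * pi) * std_normal_density w)"
      unfolding std_normal_density_def by (simp flip: exp_of_real)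
    ultimately show ?thesis
      by (simp only: exp_add scaleR_conv_of_real of_real_mult mult_ac)
  qed
  have "(LBINT x. exp (- of_real \<alpha> * of_real x ^ 2 + \<beta> * of_real x)) =
    \<bar>\<sigma>\<bar> *\<^sub>R (LBINT w. exp (- of_real \<alpha> * of_real (m + \<sigma> * w) ^ 2 + \<beta> * of_real (m + \<sigma> * w)))"
    using s by (intro lborel_integral_real_affine) auto
  also have "\<dots> = of_real \<sigma> * (of_real (sqrt (2 * pi)) * exp \<gamma> * exp (- (of_real \<tau>)\<^sup>2 / 2))"
    unfolding * using s by (simp only: integral_mult_right_zero ch abs_of_pos) (simp only: scaleR_conv_of_real)
  also have "\<dots> = of_real (\<sigma> * sqrt (2 * pi)) * exp (\<gamma> - (of_real \<tau>)\<^sup>2 / 2)"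
    by (simp only: mult_exp_exp of_real_mult mult.assoc) simp
  also have "\<sigma> * sqrt (2 * pi) = sqrt (pi / \<alpha>)"
    unfolding \<sigma>_def by (simp flip: real_sqrt_mult)
  also have "\<gamma> - (of_real \<tau>)\<^sup>2 / 2 = \<beta>\<^sup>2 / (4 * of_real \<alpha>)"
  proof -
    have b: "\<beta> = of_real (Re \<beta>) + \<i> * of_real (Im \<beta>)" by (simp add: complex_eq_iff)
    have t: "(of_real \<tau>)\<^sup>2 = (of_real ((Im \<beta>)\<^sup>2 / (2 * \<alpha>)) :: complex)"
      unfolding \<tau>_def by (simp add: power_mult_distrib s flip: of_real_power)
    show ?thesis
      using assms unfolding \<gamma>_def t m_def
      by (subst (1 2) b) (simp add: field_simps power2_eq_square)
  qed
  finally show ?thesis .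
qed

section \<open>The integrand on the critical line\<close>

text \<open>This is \<open>2 * \<i> * sin (pi * x)\<close>, so the poles of the integrand off the
  branch cut are the positive integers.\<close>

definition sine_kernel :: "complex \<Rightarrow> complex" where
  "sine_kernel x = exp (of_real pi * \<i> * x) - exp (- (of_real pi * \<i> * x))"

text \<open>The two exponentials have moduli \<open>exp (- pi * Im x)\<close> and
  \<open>exp (pi * Im x)\<close>; by the reverse triangle inequality the larger one dominates, up to
  a factor that depends only on the distance from the real axis.\<close>

lemma norm_sine_kernel_ge:
  assumes "0 \<le> h" "h \<le> \<bar>Im x\<bar>"
  shows "(1 - exp (- 2 * pi * h)) * exp (pi * \<bar>Im x\<bar>) \<le> norm (sine_kernel x)"
proof -
  have "norm (sine_kernel x) \<ge> \<bar>exp (- pi * Im x) - exp (pi * Im x)\<bar>"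
    unfolding sine_kernel_def using norm_triangle_ineq3[of "exp (of_real pi * \<i> * x)" "exp (- (of_real pi * \<i> * x))"]
    by (simp add: norm_exp_eq_Re)
  also have "\<bar>exp (- pi * Im x) - exp (pi * Im x)\<bar> = exp (pi * \<bar>Im x\<bar>) - exp (- pi * \<bar>Im x\<bar>)"
    by (cases "Im x \<ge> 0") (auto simp: abs_if mult_nonneg_nonpos zero_less_mult_iff)
  also have "exp (- pi * \<bar>Im x\<bar>) = exp (- 2 * pi * \<bar>Im x\<bar>) * exp (pi * \<bar>Im x\<bar>)"
    by (simp flip: exp_add)
  finally have "(1 - exp (- 2 * pi * \<bar>Im x\<bar>)) * exp (pi * \<bar>Im x\<bar>) \<le> norm (sine_kernel x)"
    by (simp add: algebra_simps)
  moreover have "exp (- 2 * pi * \<bar>Im x\<bar>) \<le> exp (- 2 * pi * h)" using assms by simp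
  ultimately show ?thesis
    by (smt (verit) mult_right_mono exp_ge_zero)
qed

definition crit_integrand :: "real \<Rightarrow> complex \<Rightarrow> complex" where
  "crit_integrand t = riemann_aux_integrand (1/2 - \<i> * complex_of_real t)"

lemma norm_crit_integrand:
  assumes "x \<noteq> 0"
  shows "norm (crit_integrand t x) = norm x powr (-1/2) * exp (- t * Im (Ln x)) * exp (- 2 * pi * Re x * Im x) / norm (sine_kernel x)"
proof -
  have "norm (x powr - (1/2 - \<i> * complex_of_real t)) = exp (- ln (norm x) / 2 - t * Im (Ln x))"
    using assms by (simp add: powr_def norm_exp_eq_Re)
  also have "\<dots> = norm x powr (-1/2) * exp (- t * Im (Ln x))"
    using assms by (simp add: powr_def flip: exp_add)
  finally have 1: "norm (x powr - (1/2 - \<i> * complex_of_real t)) = norm x powr (-1/2) * exp (- t * Im (Ln x))" .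
  have 2: "norm (exp (of_real pi * \<i> * x\<^sup>2)) = exp (- 2 * pi * Re x * Im x)"
    by (simp add: norm_exp_eq_Re power2_eq_square algebra_simps)
  show ?thesis
    unfolding crit_integrand_def riemann_aux_integrand_def sine_kernel_def[symmetric] norm_mult norm_divide 1 2 ..
qed

text \<open>The line of \<open>riemann_aux\<close> run at speed \<open>sqrt 2\<close>, so that
  \<open>r\<close> is the depth below the real axis. Points with the same \<open>r\<close> on two
  such lines differ by a horizontal translation.\<close>

definition diag_point :: "real \<Rightarrow> real \<Rightarrow> complex" where
  "diag_point a r = Complex (a - r) (- r)"

lemma Re_diag_point [simp]: "Re (diag_point a r) = a - r" and Im_diag_point [simp]: "Im (diag_point a r) = - r"
  by (simp_all add: diag_point_def)

lemma diag_point_eq: "diag_point a r = of_real a - of_real r * (1 + \<i>)"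
  by (simp add: complex_eq_iff)

text \<open>Substitute \<open>u = sqrt 2 * r\<close> and use
  \<open>cis (- (3 * pi / 4)) = - (1 + \<i>) / sqrt 2\<close>.\<close>

lemma riemann_aux_eq:
  "riemann_aux c (1/2 - \<i> * of_real t) = - (1 + \<i>) * (LBINT r. crit_integrand t (diag_point c r))"
proof -
  have d: "cis (- (3 * pi / 4)) = - (1 + \<i>) / of_real (sqrt 2)"
  proof -
    have "3 * pi / 4 = pi - pi / 4" by simp
    then have "cos (3 * pi / 4) = - 1 / sqrt 2" "sin (3 * pi / 4) = 1 / sqrt 2"
      by (simp_all only: cos_pi_minus sin_pi_minus cos_45 sin_45) (simp_all add: field_simps)
    then show ?thesis by (simp add: complex_eq_iff)
  qed
  have s: "complex_of_real (sqrt 2) * of_real (sqrt 2) = 2"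
    by (simp flip: of_real_mult)
  have p: "of_real c + of_real (0 + sqrt 2 * r) * cis (- (3 * pi / 4)) = diag_point c r" for r
    unfolding d diag_point_eq by (simp add: field_simps)
  have "riemann_aux c (1/2 - \<i> * of_real t) =
    \<bar>sqrt 2\<bar> *\<^sub>R (LBINT r. crit_integrand t (of_real c + of_real (0 + sqrt 2 * r) * cis (- (3 * pi / 4))) * cis (- (3 * pi / 4)))"
    unfolding riemann_aux_def crit_integrand_def by (rule lborel_integral_real_affine) simp
  also have "\<dots> = of_real (sqrt 2) * cis (- (3 * pi / 4)) * (LBINT r. crit_integrand t (diag_point c r))"
    unfolding p by (simp add: scaleR_conv_of_real)
  also have "of_real (sqrt 2) * cis (- (3 * pi / 4)) = - (1 + \<i>)"
    unfolding d by simp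
  finally show ?thesis .
qed

section \<open>Holomorphy of the integrand and bounds for its modulus\<close>

lemma sine_kernel_nonzero_Im:
  assumes x: "Im x \<noteq> 0" shows "sine_kernel x \<noteq> 0"
proof -
  have "0 < (1 - exp (- 2 * pi * \<bar>Im x\<bar>)) * exp (pi * \<bar>Im x\<bar>)"
    using x by (intro mult_pos_pos) (auto intro: mult_pos_pos)
  then show ?thesis using norm_sine_kernel_ge[of "\<bar>Im x\<bar>" x] by auto
qed

lemma sine_kernel_nonzero_real: "0 < x \<Longrightarrow> x < 1 \<Longrightarrow> sine_kernel (of_real x) \<noteq> 0"
proof -
  assume x: "0 < x" "x < 1"
  have "Im (sine_kernel (of_real x)) = 2 * sin (pi * x)" by (simp add: sine_kernel_def Im_exp)
  moreover have "sin (pi * x) > 0" using x by (intro sin_gt_zero) auto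
  ultimately show ?thesis by auto
qed

lemma holomorphic_crit_integrand: "crit_integrand t holomorphic_on {x. x \<notin> \<real>\<^sub>\<le>\<^sub>0 \<and> sine_kernel x \<noteq> 0}"
  unfolding crit_integrand_def riemann_aux_integrand_def sine_kernel_def
  by (intro holomorphic_intros) auto

text \<open>At distance at least \<open>h\<close> from the real axis both
  \<open>norm x powr (-1/2)\<close> and the reciprocal of the kernel are bounded in terms of
  \<open>h\<close> alone. What remains is the argument factor and a factor that is Gaussian along
  the diagonal lines.\<close>

lemma norm_crit_integrand_le:
  assumes "h > 0" "h \<le> \<bar>Im x\<bar>"
  shows "norm (crit_integrand t x) \<le> h powr (-1/2) / (1 - exp (- 2 * pi * h)) * exp (- t * Im (Ln x)) * exp (- 2 * pi * Re x * Im x)"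
proof -
  have x: "x \<noteq> 0" using assms by auto
  have h: "1 - exp (- 2 * pi * h) > 0" using assms by auto
  have "(1 - exp (- 2 * pi * h)) * 1 \<le> (1 - exp (- 2 * pi * h)) * exp (pi * \<bar>Im x\<bar>)"
    using h by (intro mult_left_mono) auto
  also have "\<dots> \<le> norm (sine_kernel x)" using assms by (intro norm_sine_kernel_ge) auto
  finally have k: "1 - exp (- 2 * pi * h) \<le> norm (sine_kernel x)" by simp
  have "norm x powr (-1/2) \<le> h powr (-1/2)"
    using assms abs_Im_le_cmod[of x] by (intro powr_mono2') auto
  then have "norm (crit_integrand t x) \<le> h powr (-1/2) * exp (- t * Im (Ln x)) * exp (- 2 * pi * Re x * Im x) / norm (sine_kernel x)"
    unfolding norm_crit_integrand[OF x] by (intro divide_right_mono mult_right_mono) auto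
  also have "\<dots> \<le> h powr (-1/2) * exp (- t * Im (Ln x)) * exp (- 2 * pi * Re x * Im x) / (1 - exp (- 2 * pi * h))"
    using h k by (intro divide_left_mono mult_pos_pos) auto
  finally show ?thesis by simp
qed

text \<open>The parameter \<open>t\<close> enters the modulus only through the argument of
  \<open>x\<close>. Estimates for \<open>t = 0\<close> thus carry over to every \<open>t\<close>
  once the argument is controlled.\<close>

lemma norm_crit_integrand_eq:
  assumes "x \<noteq> 0"
  shows "norm (crit_integrand t x) = exp (- t * Im (Ln x)) * norm (crit_integrand 0 x)"
  using norm_crit_integrand[OF assms, of t] norm_crit_integrand[OF assms, of 0] by simp

lemma exp_Im_Ln_le:
  assumes "x \<noteq> 0"
  shows "exp (- t * Im (Ln x)) \<le> exp (pi * \<bar>t\<bar>)"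
proof -
  have "\<bar>Im (Ln x)\<bar> \<le> pi" using Im_Ln_le_pi[OF assms] mpi_less_Im_Ln[OF assms] by simp
  then have "\<bar>t * Im (Ln x)\<bar> \<le> \<bar>t\<bar> * pi" by (simp add: abs_mult mult_left_mono)
  then show ?thesis by (simp add: mult.commute)
qed

text \<open>In the right half plane the argument is the arctangent of \<open>Im x / Re x\<close>, a
  ratio of at least -1 here. The sector contains \<open>diag_point c r\<close> for
  \<open>r \<le> c / 2\<close>, which is why the path is later cut at \<open>c / 2\<close>.\<close>

lemma Im_Ln_ge:
  assumes "Re x > 0" "Im x \<ge> - Re x"
  shows "Im (Ln x) \<ge> - pi / 4"
proof -
  have "Im (Ln x) = arctan (Im x / Re x)"
    using assms by (subst Im_Ln_eq) auto
  also have "\<dots> \<ge> arctan (-1)"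
    using assms by (simp add: arctan_le_iff field_simps)
  finally show ?thesis by (simp add: arctan_minus arctan_one)
qed

section \<open>Absolute integrability along the diagonal lines\<close>

lemma continuous_on_crit_integrand:
  assumes "0 < c" "c < 1"
  shows "continuous_on UNIV (\<lambda>r. crit_integrand t (diag_point c r))"
proof (rule continuous_on_compose2[OF holomorphic_on_imp_continuous_on[OF holomorphic_crit_integrand]])
  show "continuous_on UNIV (diag_point c)" unfolding diag_point_eq by (intro continuous_intros)
  have "diag_point c r \<notin> \<real>\<^sub>\<le>\<^sub>0 \<and> sine_kernel (diag_point c r) \<noteq> 0" for r
  proof (cases "r = 0")
    case True
    then show ?thesis using assms sine_kernel_nonzero_real[of c]
      by (auto simp: diag_point_eq)
  qed (auto simp: sine_kernel_nonzero_Im complex_nonpos_Reals_iff)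
  then show "diag_point c ` UNIV \<subseteq> {x. x \<notin> \<real>\<^sub>\<le>\<^sub>0 \<and> sine_kernel x \<noteq> 0}" by auto
qed

lemma diag_point_nonzero: "0 < c \<Longrightarrow> diag_point c r \<noteq> 0"
  by (auto simp: complex_eq_iff)

text \<open>Near the crossing with the real axis, for \<open>\<bar>r\<bar> \<le> c\<close>, the
  integrand is bounded by continuity; beyond that the bound away from the real axis gives Gaussian
  decay. Both are merged into one Gaussian majorant for \<open>t = 0\<close>, and \<open>t\<close>
  costs at most \<open>exp (pi * \<bar>t\<bar>)\<close>.\<close>

lemma integrable_crit_integrand:
  assumes c: "0 < c" "c < 1"
  shows "integrable lborel (\<lambda>r. crit_integrand t (diag_point c r))"
proof -
  have "bounded ((\<lambda>r. crit_integrand 0 (diag_point c r)) ` {-c..c})"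
    by (intro compact_imp_bounded compact_continuous_image continuous_on_subset[OF continuous_on_crit_integrand[OF c]]) auto
  then obtain B where B: "\<And>r. r \<in> {-c..c} \<Longrightarrow> norm (crit_integrand 0 (diag_point c r)) \<le> B"
    unfolding bounded_iff by blast
  \<comment> \<open>On \<open>\<bar>r\<bar> \<le> c\<close> the Gaussian is smallest at
    \<open>r = - c\<close>, where it equals \<open>exp (- 4 * pi * c\<^sup>2)\<close>; the second
    entry of the maximum compensates for this.\<close>
  define K where "K = max (c powr (-1/2) / (1 - exp (- 2 * pi * c))) (B * exp (4 * pi * c\<^sup>2))"
  have bd: "norm (crit_integrand 0 (diag_point c r)) \<le> K * exp (- (2 * pi) * r\<^sup>2 + (2 * pi * c) * r)" for r
  proof (cases "\<bar>r\<bar> \<le> c")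
    case True
    have B0: "B \<ge> 0" using order_trans[OF norm_ge_zero B[of 0]] c by auto
    have "r\<^sup>2 \<le> c\<^sup>2" using True c power_mono[of "\<bar>r\<bar>" c 2] by simp
    moreover have "- (c * r) \<le> c\<^sup>2" using mult_left_mono[of "-r" c c] True c by (simp add: power2_eq_square)
    ultimately have "2 * pi * (2 * c\<^sup>2 - r\<^sup>2 + c * r) \<ge> 0" by (intro mult_nonneg_nonneg) auto
    then have e: "1 \<le> exp (4 * pi * c\<^sup>2) * exp (- (2 * pi) * r\<^sup>2 + (2 * pi * c) * r)"
      unfolding exp_add[symmetric] one_le_exp_iff by (simp add: algebra_simps)
    have "norm (crit_integrand 0 (diag_point c r)) \<le> B * 1" using B[of r] True by (auto simp: abs_le_iff)
    also have "\<dots> \<le> B * (exp (4 * pi * c\<^sup>2) * exp (- (2 * pi) * r\<^sup>2 + (2 * pi * c) * r))"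
      using B0 e by (rule mult_left_mono[rotated])
    also have "\<dots> \<le> K * exp (- (2 * pi) * r\<^sup>2 + (2 * pi * c) * r)"
      unfolding K_def mult.assoc[symmetric] by (intro mult_right_mono) auto
    finally show ?thesis .
  next
    case False
    have "norm (crit_integrand 0 (diag_point c r)) \<le> c powr (-1/2) / (1 - exp (- 2 * pi * c)) * exp (- (2 * pi) * r\<^sup>2 + (2 * pi * c) * r)"
      using norm_crit_integrand_le[of c "diag_point c r" 0] False c by (simp add: algebra_simps power2_eq_square)
    also have "\<dots> \<le> K * exp (- (2 * pi) * r\<^sup>2 + (2 * pi * c) * r)"
      unfolding K_def by (intro mult_right_mono) auto
    finally show ?thesis .
  qed
  show ?thesis
  proof (rule Bochner_Integration.integrable_bound)
    show "integrable lborel (\<lambda>r. exp (pi * \<bar>t\<bar>) * (K * exp (- (2 * pi) * r\<^sup>2 + (2 * pi * c) * r)))"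
      by (intro integrable_mult_right integrable_exp_quadratic) auto
    show "(\<lambda>r. crit_integrand t (diag_point c r)) \<in> borel_measurable lborel"
      using borel_measurable_continuous_onI[OF continuous_on_crit_integrand[OF c]] by simp
    have "norm (crit_integrand t (diag_point c r)) \<le> norm (exp (pi * \<bar>t\<bar>) * (K * exp (- (2 * pi) * r\<^sup>2 + (2 * pi * c) * r)))" for r
    proof -
      have "norm (crit_integrand t (diag_point c r)) = exp (- t * Im (Ln (diag_point c r))) * norm (crit_integrand 0 (diag_point c r))"
        using diag_point_nonzero[OF c(1)] by (rule norm_crit_integrand_eq)
      also have "\<dots> \<le> exp (pi * \<bar>t\<bar>) * (K * exp (- (2 * pi) * r\<^sup>2 + (2 * pi * c) * r))"
        using diag_point_nonzero[OF c(1)] by (intro mult_mono exp_Im_Ln_le bd) auto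
      finally show ?thesis by (smt (verit) real_norm_def)
    qed
    then show "AE r in lborel. norm (crit_integrand t (diag_point c r)) \<le> norm (exp (pi * \<bar>t\<bar>) * (K * exp (- (2 * pi) * r\<^sup>2 + (2 * pi * c) * r)))"
      by simp
  qed
qed

text \<open>For \<open>r \<le> c / 2\<close> the argument is at least \<open>- pi / 4\<close>, so
  the factor carrying \<open>t\<close> is at most \<open>exp (pi * t / 4)\<close>; the remaining
  integral does not depend on \<open>t\<close>.\<close>

lemma norm_integral_upper_le:
  assumes c: "0 < c" "c < 1" and t: "t \<ge> 0"
  shows "norm (LBINT r:{..c/2}. crit_integrand t (diag_point c r)) \<le> exp (pi * t / 4) * (LBINT r. norm (crit_integrand 0 (diag_point c r)))"
proof -
  have "norm (LBINT r:{..c/2}. crit_integrand t (diag_point c r)) \<le> (LBINT r. exp (pi * t / 4) * norm (crit_integrand 0 (diag_point c r)))"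
    unfolding set_lebesgue_integral_def
  proof (rule Bochner_Integration.integral_norm_bound_integral)
    show "integrable lborel (\<lambda>r. indicat_real {..c/2} r *\<^sub>R crit_integrand t (diag_point c r))"
      using integrable_crit_integrand[OF c, of t] by (intro integrable_mult_indicator) auto
    show "integrable lborel (\<lambda>r. exp (pi * t / 4) * norm (crit_integrand 0 (diag_point c r)))"
      using integrable_crit_integrand[OF c, of 0] by auto
    show "norm (indicat_real {..c/2} r *\<^sub>R crit_integrand t (diag_point c r)) \<le> exp (pi * t / 4) * norm (crit_integrand 0 (diag_point c r))" for r
    proof (cases "r \<le> c/2")
      case True
      have "Im (Ln (diag_point c r)) \<ge> - pi / 4" using True c by (intro Im_Ln_ge) auto
      then have "exp (- t * Im (Ln (diag_point c r))) \<le> exp (pi * t / 4)"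
        using mult_left_mono[of "- pi / 4" "Im (Ln (diag_point c r))" t] t by (simp add: mult.commute)
      then show ?thesis using True
        by (simp add: norm_crit_integrand_eq[OF diag_point_nonzero[OF c(1)], of t] mult_right_mono)
    qed auto
  qed
  then show ?thesis by simp
qed

text \<open>At depth greater than \<open>b\<close> the ray avoids the poles and the branch cut
  wherever the line crosses the real axis, so \<open>a\<close> may be any real number.\<close>

lemma set_integrable_crit_integrand_ray:
  assumes b: "0 < b"
  shows "set_integrable lborel {b<..} (\<lambda>r. crit_integrand t (diag_point a r))"
  unfolding set_integrable_def
proof (rule Bochner_Integration.integrable_bound)
  let ?K = "exp (pi * \<bar>t\<bar>) * (b powr (-1/2) / (1 - exp (- 2 * pi * b)))"
  show "integrable lborel (\<lambda>r. ?K * exp (- (2 * pi) * r\<^sup>2 + (2 * pi * a) * r))"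
    by (intro integrable_mult_right integrable_exp_quadratic) auto
  have "continuous_on {b<..} (\<lambda>r. crit_integrand t (diag_point a r))"
  proof (rule continuous_on_compose2[OF holomorphic_on_imp_continuous_on[OF holomorphic_crit_integrand]])
    show "continuous_on {b<..} (diag_point a)" unfolding diag_point_eq by (intro continuous_intros)
    have "diag_point a r \<notin> \<real>\<^sub>\<le>\<^sub>0 \<and> sine_kernel (diag_point a r) \<noteq> 0" if "r > b" for r
      using that b sine_kernel_nonzero_Im[of "diag_point a r"] by (auto simp: complex_nonpos_Reals_iff)
    then show "diag_point a ` {b<..} \<subseteq> {x. x \<notin> \<real>\<^sub>\<le>\<^sub>0 \<and> sine_kernel x \<noteq> 0}" by auto
  qed
  then show "(\<lambda>r. indicat_real {b<..} r *\<^sub>R crit_integrand t (diag_point a r)) \<in> borel_measurable lborel"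
    using borel_measurable_continuous_on_indicator[of "{b<..}" "\<lambda>r. crit_integrand t (diag_point a r)"] by simp
  have "norm (crit_integrand t (diag_point a r)) \<le> ?K * exp (- (2 * pi) * r\<^sup>2 + (2 * pi * a) * r)" if "r > b" for r
  proof -
    have "norm (crit_integrand t (diag_point a r)) \<le> (b powr (-1/2) / (1 - exp (- 2 * pi * b))) * exp (- t * Im (Ln (diag_point a r))) * exp (- 2 * pi * (a - r) * (- r))"
      using norm_crit_integrand_le[of b "diag_point a r" t] that b by simp
    also have "\<dots> \<le> (b powr (-1/2) / (1 - exp (- 2 * pi * b))) * exp (pi * \<bar>t\<bar>) * exp (- 2 * pi * (a - r) * (- r))"
      using that b by (intro mult_right_mono mult_left_mono exp_Im_Ln_le) (auto simp: complex_eq_iff)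
    finally show ?thesis by (simp add: algebra_simps power2_eq_square)
  qed
  moreover have "0 \<le> ?K" using b by auto
  ultimately have "norm (indicat_real {b<..} r *\<^sub>R crit_integrand t (diag_point a r)) \<le> ?K * exp (- (2 * pi) * r\<^sup>2 + (2 * pi * a) * r)" for r
    by (cases "r > b") (auto intro!: mult_nonneg_nonneg simp del: times_divide_eq_right)
  then have "norm (indicat_real {b<..} r *\<^sub>R crit_integrand t (diag_point a r)) \<le> norm (?K * exp (- (2 * pi) * r\<^sup>2 + (2 * pi * a) * r))" for r
    unfolding real_norm_def by (rule order_trans[OF _ abs_ge_self])
  then show "AE r in lborel. norm (indicat_real {b<..} r *\<^sub>R crit_integrand t (diag_point a r)) \<le> norm (?K * exp (- (2 * pi) * r\<^sup>2 + (2 * pi * a) * r))"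
    by simp
qed

section \<open>Shifting the line of integration\<close>

text \<open>A primitive \<open>P\<close> in the lower half plane replaces a contour argument. The
  difference \<open>G\<close> of \<open>P\<close> along the two rays vanishes at infinity, and the
  difference of the two integrals is \<open>G b / (1 + \<i>)\<close>. In turn \<open>G b\<close> is
  controlled by the integrand on a horizontal segment of length \<open>a - c\<close>.\<close>

lemma norm_integral_shift_le:
  assumes b: "0 < b" "2 * b \<le> c" and "c \<le> a" and t: "t \<ge> 0"
  shows "norm ((LBINT r:{b<..}. crit_integrand t (diag_point c r)) - (LBINT r:{b<..}. crit_integrand t (diag_point a r)))
    \<le> b powr (-1/2) / (1 - exp (- 2 * pi * b)) * exp (pi * t / 4) * exp (2 * pi * (a - b) * b) * (a - c)"
proof -
  let ?K = "b powr (-1/2) / (1 - exp (- 2 * pi * b))"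
  have K: "?K \<ge> 0" using b by auto
  have ca: "c \<le> a" by fact
  define H where "H = {x::complex. Im x < 0}"
  have H: "convex H" "open H"
    unfolding H_def by (auto simp: convex_halfspace_Im_lt open_halfspace_Im_lt)
  have "crit_integrand t holomorphic_on H"
    by (rule holomorphic_on_subset[OF holomorphic_crit_integrand])
       (auto simp: H_def sine_kernel_nonzero_Im complex_nonpos_Reals_iff)
  from holomorphic_convex_primitive'[OF H this]
  obtain P where P: "\<And>x. x \<in> H \<Longrightarrow> (P has_field_derivative crit_integrand t x) (at x within H)" by blast
  \<comment> \<open>Both points have depth \<open>r\<close>, so the mean value inequality for
    \<open>P\<close> applies on a horizontal segment.\<close>
  have bnd: "norm (P (diag_point c r) - P (diag_point a r)) \<le> B * (a - c)"
    if "r \<ge> b" and B: "\<And>\<xi>. c \<le> \<xi> \<Longrightarrow> \<xi> \<le> a \<Longrightarrow> norm (crit_integrand t (diag_point \<xi> r)) \<le> B" for r B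
  proof -
    have seg: "\<exists>\<xi>\<in>{c..a}. x = diag_point \<xi> r" if "x \<in> closed_segment (diag_point c r) (diag_point a r)" for x
    proof -
      have "Im x = - r" using that closed_segment_same_Im[of "diag_point c r" "diag_point a r"] by auto
      moreover have "Re x \<in> {c - r..a - r}"
        using that ca closed_segment_same_Im[of "diag_point c r" "diag_point a r"] by (auto simp: closed_segment_eq_real_ivl)
      ultimately show ?thesis by (intro bexI[of _ "Re x + r"]) (auto simp: complex_eq_iff)
    qed
    have "norm (P (diag_point c r) - P (diag_point a r)) \<le> B * norm (diag_point c r - diag_point a r)"
    proof (rule field_differentiable_bound[where S = "closed_segment (diag_point c r) (diag_point a r)"])
      show "(P has_field_derivative crit_integrand t x) (at x within closed_segment (diag_point c r) (diag_point a r))"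
        if "x \<in> closed_segment (diag_point c r) (diag_point a r)" for x
        using seg[OF that] seg \<open>r \<ge> b\<close> b
        by (intro DERIV_subset[OF P]) (force simp: H_def)+
      show "norm (crit_integrand t x) \<le> B" if "x \<in> closed_segment (diag_point c r) (diag_point a r)" for x
        using seg[OF that] B by auto
    qed auto
    also have "norm (diag_point c r - diag_point a r) = a - c"
      using ca by (simp add: diag_point_eq flip: of_real_diff)
    finally show ?thesis .
  qed
  define G where "G r = P (diag_point c r) - P (diag_point a r)" for r
  have dP: "((\<lambda>r. P (diag_point d r)) has_vector_derivative - (1 + \<i>) * crit_integrand t (diag_point d r)) (at r)" if "r > 0" for d r
  proof -
    have "(P has_field_derivative crit_integrand t (diag_point d r)) (at (diag_point d r))"
      using P[of "diag_point d r"] at_within_open[of "diag_point d r" H] H(2) that by (simp add: H_def)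
    moreover have "(diag_point d has_vector_derivative - (1 + \<i>)) (at r)"
      unfolding diag_point_eq by (auto intro!: derivative_eq_intros)
    ultimately show ?thesis
      using field_vector_diff_chain_at[of "diag_point d" "- (1 + \<i>)" r P] by (simp add: o_def)
  qed
  have dG: "(G has_vector_derivative - (1 + \<i>) * (crit_integrand t (diag_point c r) - crit_integrand t (diag_point a r))) (at r)" if "r > 0" for r
    unfolding G_def by (rule has_vector_derivative_eq_rhs[OF has_vector_derivative_diff[OF dP dP]])
      (use that in \<open>auto simp: algebra_simps\<close>)
  \<comment> \<open>For the limit the crude factor \<open>exp (pi * \<bar>t\<bar>)\<close> is good
    enough, since \<open>exp (2 * pi * (a - r) * r)\<close> has Gaussian decay in
    \<open>r\<close>.\<close>
  have G0: "(G \<longlongrightarrow> 0) at_top"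
  proof (rule Lim_null_comparison)
    show "\<forall>\<^sub>F r in at_top. norm (G r) \<le> (?K * exp (pi * \<bar>t\<bar>) * exp (2 * pi * (a - r) * r)) * (a - c)"
      using eventually_ge_at_top[of b]
    proof eventually_elim
      case (elim r)
      show ?case unfolding G_def
      proof (rule bnd[OF elim])
        fix \<xi> assume \<xi>: "c \<le> \<xi>" "\<xi> \<le> a"
        have "norm (crit_integrand t (diag_point \<xi> r)) \<le> ?K * exp (- t * Im (Ln (diag_point \<xi> r))) * exp (- 2 * pi * (\<xi> - r) * (- r))"
          using norm_crit_integrand_le[of b "diag_point \<xi> r" t] elim b by simp
        also have "\<dots> \<le> ?K * exp (pi * \<bar>t\<bar>) * exp (2 * pi * (a - r) * r)"
          using K elim b \<xi> by (intro mult_mono mult_left_mono exp_Im_Ln_le) (auto simp: complex_eq_iff)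
        finally show "norm (crit_integrand t (diag_point \<xi> r)) \<le> ?K * exp (pi * \<bar>t\<bar>) * exp (2 * pi * (a - r) * r)" .
      qed
    qed
    show "((\<lambda>r. ?K * exp (pi * \<bar>t\<bar>) * exp (2 * pi * (a - r) * r) * (a - c)) \<longlongrightarrow> 0) at_top"
      by (intro tendsto_mult_left_zero tendsto_mult_right_zero) real_asymp
  qed
  have Gb: "norm (G b) \<le> ?K * exp (pi * t / 4) * exp (2 * pi * (a - b) * b) * (a - c)"
    unfolding G_def
  proof (rule bnd[OF order_refl])
    fix \<xi> assume \<xi>: "c \<le> \<xi>" "\<xi> \<le> a"
    \<comment> \<open>Here \<open>2 * b \<le> c \<le> \<xi>\<close> places the whole segment in the
      sector, which yields \<open>pi * t / 4\<close> in place of \<open>pi * t\<close>.\<close>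
    have "Im (Ln (diag_point \<xi> b)) \<ge> - pi / 4" using \<xi> b by (intro Im_Ln_ge) auto
    then have e: "exp (- t * Im (Ln (diag_point \<xi> b))) \<le> exp (pi * t / 4)"
      using mult_left_mono[of "- pi / 4" "Im (Ln (diag_point \<xi> b))" t] t by (simp add: mult.commute)
    have "norm (crit_integrand t (diag_point \<xi> b)) \<le> ?K * exp (- t * Im (Ln (diag_point \<xi> b))) * exp (- 2 * pi * (\<xi> - b) * (- b))"
      using norm_crit_integrand_le[of b "diag_point \<xi> b" t] b by simp
    also have "\<dots> \<le> ?K * exp (pi * t / 4) * exp (2 * pi * (a - b) * b)"
      using K b \<xi> e by (intro mult_mono mult_left_mono) auto
    finally show "norm (crit_integrand t (diag_point \<xi> b)) \<le> ?K * exp (pi * t / 4) * exp (2 * pi * (a - b) * b)" .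
  qed
  have int: "set_integrable lborel {b<..} (\<lambda>r. - (1 + \<i>) * (crit_integrand t (diag_point c r) - crit_integrand t (diag_point a r)))"
    by (intro set_integrable_mult_right set_integral_diff(1) set_integrable_crit_integrand_ray b)
  have "(LBINT r=ereal b..\<infinity>. - (1 + \<i>) * (crit_integrand t (diag_point c r) - crit_integrand t (diag_point a r))) = 0 - G b"
  proof (rule interval_integral_FTC_integrable)
    show "set_integrable lborel (einterval (ereal b) \<infinity>) (\<lambda>r. - (1 + \<i>) * (crit_integrand t (diag_point c r) - crit_integrand t (diag_point a r)))"
      using int by simp
    show "(G has_vector_derivative - (1 + \<i>) * (crit_integrand t (diag_point c r) - crit_integrand t (diag_point a r))) (at r)"
      if "ereal b < ereal r" for r using that b by (intro dG) auto
    have "isCont (crit_integrand t) x" if "Im x < 0" for x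
      using holomorphic_on_imp_continuous_on[OF \<open>crit_integrand t holomorphic_on H\<close>] H that
      by (auto simp: continuous_on_eq_continuous_at H_def)
    moreover have "isCont (diag_point d) r" for d r unfolding diag_point_eq by (intro continuous_intros)
    ultimately have "isCont (\<lambda>r. crit_integrand t (diag_point d r)) r" if "r > 0" for d r
      using that by (intro isCont_o2[of r "diag_point d" "crit_integrand t"]) auto
    then show "isCont (\<lambda>r. - (1 + \<i>) * (crit_integrand t (diag_point c r) - crit_integrand t (diag_point a r))) r" if "ereal b < ereal r" for r
      using that b by (intro continuous_intros) auto
    show "((G \<circ> real_of_ereal) \<longlongrightarrow> G b) (at_right (ereal b))"
      unfolding ereal_tendsto_simps1
      using has_vector_derivative_continuous[OF dG[OF b(1)]]
      by (simp add: continuous_at tendsto_within_subset[of G _ _ UNIV])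
    show "((G \<circ> real_of_ereal) \<longlongrightarrow> 0) (at_left \<infinity>)"
      unfolding ereal_tendsto_simps1 by (rule G0)
  qed auto
  also have "(LBINT r=ereal b..\<infinity>. - (1 + \<i>) * (crit_integrand t (diag_point c r) - crit_integrand t (diag_point a r))) =
    - (1 + \<i>) * ((LBINT r:{b<..}. crit_integrand t (diag_point c r)) - (LBINT r:{b<..}. crit_integrand t (diag_point a r)))"
    unfolding interval_integral_to_infinity_eq
    by (simp only: set_integral_mult_right set_integral_diff(2)[OF set_integrable_crit_integrand_ray[OF b(1)] set_integrable_crit_integrand_ray[OF b(1)]])
  finally have "norm (G b) = norm (1 + \<i>) * norm ((LBINT r:{b<..}. crit_integrand t (diag_point c r)) - (LBINT r:{b<..}. crit_integrand t (diag_point a r)))"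
    by (metis diff_0 norm_minus_cancel norm_mult)
  moreover have "norm (1 + \<i>) \<ge> 1"
    using abs_Re_le_cmod[of "1 + \<i>"] by simp
  ultimately have "norm ((LBINT r:{b<..}. crit_integrand t (diag_point c r)) - (LBINT r:{b<..}. crit_integrand t (diag_point a r))) \<le> norm (G b)"
    by (metis mult_le_cancel_right1 norm_not_less_zero)
  then show ?thesis using Gb by linarith
qed

section \<open>The saddle point\<close>

text \<open>Mean value inequality on the segment from \<open>u\<close> to \<open>v\<close>, where
  the real part is at most its larger endpoint value. It does not require \<open>u - v\<close> to be
  small, so it can be used far from the saddle.\<close>

lemma norm_exp_diff_le:
  fixes u v :: complex
  shows "norm (exp u - exp v) \<le> exp (max (Re u) (Re v)) * norm (u - v)"
proof (rule field_differentiable_bound[where S = "closed_segment u v"])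
  show "(exp has_field_derivative exp x) (at x within closed_segment u v)" for x :: complex
    by (rule DERIV_subset[OF DERIV_exp]) auto
  fix x assume "x \<in> closed_segment u v"
  then obtain s where s: "0 \<le> s" "s \<le> 1" "x = (1 - s) *\<^sub>R u + s *\<^sub>R v"
    by (auto simp: in_segment)
  have "Re x = (1 - s) * Re u + s * Re v" using s by simp
  also have "\<dots> \<le> (1 - s) * max (Re u) (Re v) + s * max (Re u) (Re v)"
    using s by (intro add_mono mult_left_mono) auto
  finally have "Re x \<le> max (Re u) (Re v)" by (simp add: algebra_simps)
  then show "norm (exp x) \<le> exp (max (Re u) (Re v))" by (simp add: norm_exp_eq_Re)
qed auto

text \<open>Equal to \<open>p * (\<i> - 1)\<close>, the displacement from the saddle in units of
  \<open>a\<close>: with \<open>p = y / a\<close> the point \<open>diag_point a (a - y)\<close> is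
  \<open>- \<i> * a * (1 + \<zeta> p)\<close>. For \<open>a > 0\<close>, the lower half plane
  corresponds to \<open>p < 1\<close>.\<close>

definition \<zeta> :: "real \<Rightarrow> complex" where "\<zeta> p = Complex (- p) p"

lemma Re_zeta [simp]: "Re (\<zeta> p) = - p" and Im_zeta [simp]: "Im (\<zeta> p) = p"
  by (simp_all add: \<zeta>_def)

lemma norm_zeta: "norm (\<zeta> p) = sqrt 2 * \<bar>p\<bar>"
  by (simp add: cmod_def real_sqrt_mult flip: mult_2)

text \<open>The bound is the distance of the line from the origin, attained at
  \<open>p = 1 / 2\<close>.\<close>

lemma norm_one_plus_zeta_ge: "norm (1 + \<zeta> p) \<ge> 1 / sqrt 2"
proof -
  have "1 / 2 \<le> (1 - p)\<^sup>2 + p\<^sup>2"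
    using zero_le_power2[of "2 * p - 1"] by (simp add: power2_eq_square algebra_simps)
  then have "sqrt (1 / 2) \<le> norm (1 + \<zeta> p)"
    unfolding cmod_def by (intro real_sqrt_le_mono) simp
  then show ?thesis by (simp add: real_sqrt_divide)
qed

lemma zeta_segment:
  assumes "w \<in> closed_segment 0 (\<zeta> p)" "p < 1"
  shows "\<exists>q. w = \<zeta> q \<and> \<bar>q\<bar> \<le> \<bar>p\<bar> \<and> q < 1"
proof -
  obtain s where s: "0 \<le> s" "s \<le> 1" "w = s *\<^sub>R \<zeta> p"
    using assms by (auto simp: in_segment)
  have "s * p < 1"
  proof (cases "p \<ge> 0")
    case True
    then have "s * p \<le> 1 * p" using s by (intro mult_right_mono)
    then show ?thesis using assms by simp
  next
    case False
    then have "s * p \<le> 0" using s by (simp add: mult_nonneg_nonpos)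
    then show ?thesis by simp
  qed
  moreover have "\<bar>s * p\<bar> \<le> 1 * \<bar>p\<bar>" unfolding abs_mult using s by (intro mult_right_mono) auto
  ultimately show ?thesis using s by (intro exI[of _ "s * p"]) (auto simp: complex_eq_iff)
qed

section \<open>The logarithm on the ray through the rescaled saddle\<close>

lemma one_plus_zeta_notin: "p < 1 \<Longrightarrow> 1 + \<zeta> p \<notin> \<real>\<^sub>\<le>\<^sub>0"
  by (auto simp: complex_nonpos_Reals_iff)

lemma norm_inverse_zeta_le: "1 / norm (1 + \<zeta> p) \<le> sqrt 2"
proof -
  have "norm (1 + \<zeta> p) > 0" using norm_one_plus_zeta_ge[of p] by (smt (verit) zero_less_divide_1_iff real_sqrt_gt_zero)
  then show ?thesis using norm_one_plus_zeta_ge[of p] by (simp add: field_simps)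
qed

text \<open>The derivative \<open>1 / (1 + w)\<close> is at most \<open>sqrt 2\<close> in modulus
  along the segment, whose length is \<open>sqrt 2 * \<bar>p\<bar>\<close>.\<close>

lemma norm_Ln_zeta_le:
  assumes "p < 1"
  shows "norm (Ln (1 + \<zeta> p)) \<le> 2 * \<bar>p\<bar>"
proof -
  have "norm (Ln (1 + \<zeta> p) - Ln (1 + 0)) \<le> sqrt 2 * norm (\<zeta> p - 0)"
  proof (rule field_differentiable_bound[where S = "closed_segment 0 (\<zeta> p)" and f = "\<lambda>w. Ln (1 + w)"])
    fix w assume "w \<in> closed_segment 0 (\<zeta> p)"
    then obtain q where q: "w = \<zeta> q" "\<bar>q\<bar> \<le> \<bar>p\<bar>" "q < 1" using zeta_segment assms by blast
    show "((\<lambda>w. Ln (1 + w)) has_field_derivative 1 / (1 + w)) (at w within closed_segment 0 (\<zeta> p))"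
      using one_plus_zeta_notin[OF q(3)] q(1) by (auto intro!: derivative_eq_intros simp: field_simps)
    show "norm (1 / (1 + w)) \<le> sqrt 2"
      using norm_inverse_zeta_le[of q] q(1) by (simp add: norm_divide)
  qed auto
  also have "sqrt 2 * norm (\<zeta> p - 0) = (sqrt 2 * sqrt 2) * \<bar>p\<bar>"
    by (simp only: norm_zeta diff_zero mult.assoc)
  finally show ?thesis by simp
qed

text \<open>The remainder has derivative \<open>w\<^sup>2 / (1 + w)\<close>, which is integrated
  along the segment from 0. This avoids the power series, so the bound also covers
  \<open>\<zeta> p\<close> outside the unit disc.\<close>

lemma norm_Ln_zeta_remainder_le:
  assumes "p < 1"
  shows "norm (Ln (1 + \<zeta> p) - \<zeta> p + (\<zeta> p)\<^sup>2 / 2) \<le> 4 * \<bar>p\<bar> ^ 3"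
proof -
  let ?f = "\<lambda>w. Ln (1 + w) - w + w\<^sup>2 / 2"
  have "norm (?f (\<zeta> p) - ?f 0) \<le> (sqrt 2 * (sqrt 2 * \<bar>p\<bar>)\<^sup>2) * norm (\<zeta> p - 0)"
  proof (rule field_differentiable_bound[where S = "closed_segment 0 (\<zeta> p)" and f = ?f])
    fix w assume "w \<in> closed_segment 0 (\<zeta> p)"
    then obtain q where q: "w = \<zeta> q" "\<bar>q\<bar> \<le> \<bar>p\<bar>" "q < 1" using zeta_segment assms by blast
    have nz: "1 + w \<noteq> 0" using one_plus_zeta_notin[OF q(3)] q(1) by auto
    show "(?f has_field_derivative w\<^sup>2 / (1 + w)) (at w within closed_segment 0 (\<zeta> p))"
    proof (rule DERIV_cong)
      show "(?f has_field_derivative 1 / (1 + w) - 1 + w) (at w within closed_segment 0 (\<zeta> p))"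
        using one_plus_zeta_notin[OF q(3)] q(1) by (auto intro!: derivative_eq_intros simp: field_simps)
      show "1 / (1 + w) - 1 + w = w\<^sup>2 / (1 + w)"
        using nz by (simp add: field_simps power2_eq_square)
    qed
    have "norm (w\<^sup>2 / (1 + w)) = (1 / norm (1 + \<zeta> q)) * (sqrt 2 * \<bar>q\<bar>)\<^sup>2"
      by (simp add: norm_divide norm_power q(1) norm_zeta)
    also have "\<dots> \<le> sqrt 2 * (sqrt 2 * \<bar>p\<bar>)\<^sup>2"
      using q by (intro mult_mono norm_inverse_zeta_le power_mono mult_left_mono) auto
    finally show "norm (w\<^sup>2 / (1 + w)) \<le> sqrt 2 * (sqrt 2 * \<bar>p\<bar>)\<^sup>2" .
  qed auto
  also have "(sqrt 2 * (sqrt 2 * \<bar>p\<bar>)\<^sup>2) * norm (\<zeta> p - 0) = (sqrt 2 * sqrt 2) * (sqrt 2 * sqrt 2) * \<bar>p\<bar> ^ 3"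
    by (simp only: norm_zeta diff_zero power2_eq_square power3_eq_cube mult_ac)
  finally show ?thesis by simp
qed

text \<open>This bound holds for all \<open>p < 1\<close>, so the shifted integrand has a Gaussian majorant on the
  whole ray and no separate treatment of the tails is needed.\<close>

lemma Im_Ln_zeta_ge:
  assumes "p < 1"
  shows "Im (Ln (1 + \<zeta> p)) \<ge> p - p\<^sup>2 / 2"
proof -
  define h where "h p = arctan (p / (1 - p)) - p + p\<^sup>2 / 2" for p :: real
  \<comment> \<open>In this factored form the derivative of \<open>h\<close> visibly has the sign of
    \<open>p\<close>, so \<open>h\<close> is minimal at 0, where it vanishes.\<close>
  define h' where "h' p = p * (2 * (p - 1)\<^sup>2 + 1) / ((1 - p)\<^sup>2 + p\<^sup>2)" for p :: real
  have dh: "(h has_real_derivative h' p) (at p)" if "p < 1" for p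
  proof -
    have nz: "(1 - p)\<^sup>2 + p\<^sup>2 \<noteq> 0" using that by (simp add: sum_power2_eq_zero_iff)
    have e: "1 + (p / (1 - p))\<^sup>2 = ((1 - p)\<^sup>2 + p\<^sup>2) / (1 - p)\<^sup>2"
      using that by (simp add: power_divide field_simps)
    have "((\<lambda>p. p / (1 - p)) has_real_derivative 1 / (1 - p)\<^sup>2) (at p)"
      using that by (auto intro!: derivative_eq_intros simp: field_simps power2_eq_square)
    then have "((\<lambda>p. arctan (p / (1 - p))) has_real_derivative inverse (1 + (p / (1 - p))\<^sup>2) * (1 / (1 - p)\<^sup>2)) (at p)"
      by (rule DERIV_chain'[OF _ DERIV_arctan, THEN DERIV_cong]) simp
    also have "inverse (1 + (p / (1 - p))\<^sup>2) * (1 / (1 - p)\<^sup>2) = 1 / ((1 - p)\<^sup>2 + p\<^sup>2)"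
      unfolding e using that by (simp add: field_simps)
    finally have "((\<lambda>p. arctan (p / (1 - p))) has_real_derivative 1 / ((1 - p)\<^sup>2 + p\<^sup>2)) (at p)" .
    moreover have "((\<lambda>p. p\<^sup>2 / 2) has_real_derivative p) (at p)"
      by (auto intro!: derivative_eq_intros)
    ultimately have "(h has_real_derivative 1 / ((1 - p)\<^sup>2 + p\<^sup>2) - 1 + p) (at p)"
      unfolding h_def by (intro DERIV_add DERIV_diff DERIV_ident)
    also have "1 / ((1 - p)\<^sup>2 + p\<^sup>2) - 1 + p = h' p"
      unfolding h'_def using nz by (simp add: divide_simps) (simp add: power2_eq_square algebra_simps)
    finally show ?thesis .
  qed
  have "h p \<ge> h 0"
  proof (cases "p \<ge> 0")
    case True
    show ?thesis
    proof (rule DERIV_nonneg_imp_nondecreasing[OF True])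
      fix x assume "0 \<le> x" "x \<le> p"
      then show "\<exists>y. DERIV h x :> y \<and> 0 \<le> y"
        using dh[of x] assms by (intro exI[of _ "h' x"]) (auto simp: h'_def)
    qed
  next
    case False
    then have "p \<le> 0" by simp
    then show ?thesis
    proof (rule DERIV_nonpos_imp_nonincreasing)
      fix x assume "p \<le> x" "x \<le> 0"
      then show "\<exists>y. DERIV h x :> y \<and> y \<le> 0"
        using dh[of x] by (intro exI[of _ "h' x"]) (auto simp: h'_def intro!: divide_nonpos_nonneg mult_nonpos_nonneg)
    qed
  qed
  moreover have "Im (Ln (1 + \<zeta> p)) = arctan (p / (1 - p))"
    using assms by (subst Im_Ln_eq) (auto simp: complex_eq_iff)
  ultimately show ?thesis by (simp add: h_def)
qed

text \<open>With \<open>t = 2 * pi * a\<^sup>2\<close> the three terms come from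
  \<open>x powr (\<i> * t) * exp (pi * \<i> * x\<^sup>2)\<close>, from \<open>x powr (-1/2)\<close>,
  and from \<open>exp (pi * \<i> * x)\<close>, the dominant exponential of the denominator in the
  lower half plane; their values at the saddle have been removed.\<close>

definition saddle_exponent :: "real \<Rightarrow> real \<Rightarrow> complex" where
  "saddle_exponent a y = 2 * of_real (pi * a\<^sup>2) * \<i> * (Ln (1 + \<zeta> (y / a)) - \<zeta> (y / a) - (\<zeta> (y / a))\<^sup>2 / 2)
     - Ln (1 + \<zeta> (y / a)) / 2 - of_real (pi * a) * \<zeta> (y / a)"

text \<open>Obtained from \<open>saddle_exponent\<close> by replacing \<open>Ln (1 + z)\<close> with
  \<open>z - z\<^sup>2 / 2\<close> in the large term and with 0 in the term
  \<open>- Ln (1 + z) / 2\<close>. The result does not depend on \<open>a\<close>.\<close>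

definition gauss_exponent :: "real \<Rightarrow> complex" where
  "gauss_exponent y = - of_real (4 * pi) * of_real y ^ 2 + of_real pi * (1 - \<i>) * of_real y"

text \<open>A logarithm of the integrand at \<open>x = - \<i> * a\<close>, with
  \<open>exp (pi * \<i> * x)\<close> as denominator and \<open>t = 2 * pi * a\<^sup>2\<close>. At
  this point the derivative of \<open>\<i> * t * Ln x + pi * \<i> * x\<^sup>2\<close>
  vanishes.\<close>

definition saddle_value :: "real \<Rightarrow> complex" where
  "saddle_value a = - of_real (ln a) / 2 + \<i> * of_real pi / 4 + 2 * of_real (pi * a\<^sup>2) * \<i> * of_real (ln a)
      + of_real (pi\<^sup>2 * a\<^sup>2) - \<i> * of_real (pi * a\<^sup>2) - of_real (pi * a)"

text \<open>Pull \<open>exp (pi * \<i> * x)\<close> out of the denominator and expand the square.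
  The logarithm splits without a jump because \<open>1 + z\<close> lies in the right half plane and
  \<open>- \<i>\<close> has argument \<open>- pi / 2\<close>.\<close>

lemma crit_integrand_saddle:
  assumes a: "a > 0" and y: "y < a"
  shows "crit_integrand (2 * pi * a\<^sup>2) (diag_point a (a - y)) =
    exp (saddle_value a) * (exp (saddle_exponent a y) / (1 - exp (- (2 * of_real pi * \<i> * diag_point a (a - y)))))"
proof -
  define z where "z = \<zeta> (y / a)"
  define x where "x = diag_point a (a - y)"
  have p: "y / a < 1" using assms by simp
  have x: "x = of_real a * (- \<i> * (1 + z))"
    using a by (simp add: x_def z_def complex_eq_iff field_simps)
  have z0: "1 + z \<noteq> 0" using one_plus_zeta_notin[OF p] by (auto simp: z_def)
  have "\<bar>Im (Ln (1 + z))\<bar> < pi / 2"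
    using p z0 by (subst Re_Ln_pos_lt) (auto simp: z_def)
  then have "Ln (- \<i> * (1 + z)) = Ln (- \<i>) + Ln (1 + z)"
    using z0 by (intro Ln_times_simple) auto
  then have Ln: "Ln x = of_real (ln a) - \<i> * of_real pi / 2 + Ln (1 + z)"
    unfolding x using a z0 by (subst Ln_times_of_real) (auto simp: Ln_of_real)
  have x0: "x \<noteq> 0" using a z0 unfolding x by simp
  have k: "exp (of_real pi * \<i> * x) - exp (- (of_real pi * \<i> * x)) =
      exp (of_real pi * \<i> * x) * (1 - exp (- (2 * of_real pi * \<i> * x)))"
    by (simp add: right_diff_distrib algebra_simps flip: exp_add)
  have "crit_integrand (2 * pi * a\<^sup>2) x =
     exp (- (1 / 2 - \<i> * of_real (2 * pi * a\<^sup>2)) * Ln x) * exp (of_real pi * \<i> * x\<^sup>2) / exp (of_real pi * \<i> * x)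
       / (1 - exp (- (2 * of_real pi * \<i> * x)))"
    unfolding crit_integrand_def riemann_aux_integrand_def k using x0 by (simp add: powr_def)
  also have "exp (- (1 / 2 - \<i> * of_real (2 * pi * a\<^sup>2)) * Ln x) * exp (of_real pi * \<i> * x\<^sup>2) / exp (of_real pi * \<i> * x)
    = exp (- (1 / 2 - \<i> * of_real (2 * pi * a\<^sup>2)) * Ln x + of_real pi * \<i> * x\<^sup>2 - of_real pi * \<i> * x)"
    by (simp add: exp_add exp_diff)
  also have "- (1 / 2 - \<i> * of_real (2 * pi * a\<^sup>2)) * Ln x + of_real pi * \<i> * x\<^sup>2 - of_real pi * \<i> * x =
     saddle_value a + saddle_exponent a y"
    unfolding Ln unfolding x saddle_value_def saddle_exponent_def z_def[symmetric]
    by (simp add: complex_eq_iff algebra_simps power2_eq_square)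
  finally show ?thesis by (simp add: exp_add x_def)
qed

section \<open>Comparison of the exact exponent with the Gaussian one\<close>

lemma gauss_exponent_eq:
  assumes "a > 0"
  shows "gauss_exponent y = 2 * of_real (pi * a\<^sup>2) * \<i> * (- (\<zeta> (y / a))\<^sup>2) - of_real (pi * a) * \<zeta> (y / a)"
  using assms unfolding gauss_exponent_def
  by (simp add: complex_eq_iff power2_eq_square field_simps)

lemma Re_gauss_exponent: "Re (gauss_exponent y) = - 4 * pi * y\<^sup>2 + pi * y"
  by (simp add: gauss_exponent_def power2_eq_square)

text \<open>The lower bound for the argument keeps a quarter of the Gaussian coefficient
  \<open>4 * pi\<close>, on the whole ray. The constant \<open>1 / 2\<close> comes from
  \<open>ln (norm (1 + \<zeta> p)) \<ge> - 1\<close>.\<close>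

lemma Re_saddle_exponent_le:
  assumes a: "a > 0" and y: "y < a"
  shows "Re (saddle_exponent a y) \<le> - pi * y\<^sup>2 + pi * y + 1 / 2"
proof -
  define p where "p = y / a"
  have p: "p < 1" using assms by (simp add: p_def)
  have ya: "y = a * p" using a by (simp add: p_def)
  have "1 / 2 \<le> 1 / sqrt 2" using sqrt2_less_2 by (simp add: field_simps)
  then have "1 / 2 \<le> norm (1 + \<zeta> p)" using norm_one_plus_zeta_ge[of p] by linarith
  then have "ln (1 / 2) \<le> ln (norm (1 + \<zeta> p))" by (subst ln_le_cancel_iff) auto
  moreover have "ln (1 / 2) \<ge> (- 1 :: real)" using ln_2_less_1 by (simp add: ln_div)
  ultimately have 1: "ln (norm (1 + \<zeta> p)) \<ge> - 1" by linarith
  have nz: "1 + \<zeta> p \<noteq> 0" using one_plus_zeta_notin[OF p] by auto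
  have "Re (saddle_exponent a y) = - 2 * pi * a\<^sup>2 * (Im (Ln (1 + \<zeta> p)) - p + p\<^sup>2) - ln (norm (1 + \<zeta> p)) / 2 + pi * a * p"
    unfolding saddle_exponent_def p_def[symmetric]
    using nz by (simp add: power2_eq_square)
  also have "\<dots> \<le> - 2 * pi * a\<^sup>2 * (p\<^sup>2 / 2) + 1 / 2 + pi * a * p"
  proof -
    have "2 * pi * a\<^sup>2 * (p\<^sup>2 / 2) \<le> 2 * pi * a\<^sup>2 * (Im (Ln (1 + \<zeta> p)) - p + p\<^sup>2)"
      using Im_Ln_zeta_ge[OF p] by (intro mult_left_mono) auto
    then show ?thesis using 1 by linarith
  qed
  finally show ?thesis by (simp add: ya power_mult_distrib)
qed

text \<open>The cubic remainder times \<open>2 * pi * a\<^sup>2\<close> gives the term in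
  \<open>\<bar>y\<bar> ^ 3\<close>, and the halved logarithm gives the linear one; each loses one
  power of \<open>a\<close> after \<open>p = y / a\<close>.\<close>

lemma norm_saddle_minus_gauss_le:
  assumes a: "a > 0" and y: "y < a"
  shows "norm (saddle_exponent a y - gauss_exponent y) \<le> (8 * pi * \<bar>y\<bar> ^ 3 + \<bar>y\<bar>) / a"
proof -
  define p where "p = y / a"
  have p: "p < 1" using assms by (simp add: p_def)
  have ya: "\<bar>y\<bar> = a * \<bar>p\<bar>" using a by (simp add: p_def abs_mult)
  have "saddle_exponent a y - gauss_exponent y =
     2 * of_real (pi * a\<^sup>2) * \<i> * (Ln (1 + \<zeta> p) - \<zeta> p + (\<zeta> p)\<^sup>2 / 2) - Ln (1 + \<zeta> p) / 2"
    unfolding gauss_exponent_eq[OF a] saddle_exponent_def p_def[symmetric] by (simp add: algebra_simps)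
  also have "norm \<dots> \<le> norm (2 * of_real (pi * a\<^sup>2) * \<i> * (Ln (1 + \<zeta> p) - \<zeta> p + (\<zeta> p)\<^sup>2 / 2)) + norm (Ln (1 + \<zeta> p) / 2)"
    by (rule norm_triangle_ineq4)
  also have "\<dots> = 2 * (pi * a\<^sup>2) * norm (Ln (1 + \<zeta> p) - \<zeta> p + (\<zeta> p)\<^sup>2 / 2) + norm (Ln (1 + \<zeta> p)) / 2"
    by (simp add: norm_mult norm_divide norm_power)
  also have "\<dots> \<le> 2 * (pi * a\<^sup>2) * (4 * \<bar>p\<bar> ^ 3) + 2 * \<bar>p\<bar> / 2"
    using norm_Ln_zeta_remainder_le[OF p] norm_Ln_zeta_le[OF p]
    by (intro add_mono mult_left_mono divide_right_mono) auto
  also have "\<dots> = (8 * pi * \<bar>y\<bar> ^ 3 + \<bar>y\<bar>) / a"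
    unfolding ya using a by (simp add: add_divide_distrib power2_eq_square power3_eq_cube)
  finally show ?thesis .
qed

text \<open>The first summand covers the change of exponent: powers of \<open>\<bar>y\<bar>\<close>
  are replaced by exponentials so that only Gaussians are integrated, and
  \<open>432 * pi + 2 = 2 * (8 * pi * 27 + 1)\<close>. The second covers the subdominant exponential
  of the denominator.\<close>

definition saddle_majorant :: "real \<Rightarrow> real \<Rightarrow> real" where
  "saddle_majorant b y = ((432 * pi + 2) * (exp y + exp (- y)) + 2 / (1 - exp (- 2 * pi * b)) * exp (2 * pi * y)) * exp (- pi * y\<^sup>2 + pi * y)"

lemma integrable_saddle_majorant: "integrable lborel (saddle_majorant b)"
proof -
  have "integrable lborel (\<lambda>y. (432 * pi + 2) * exp (- pi * y\<^sup>2 + (pi + 1) * y) + (432 * pi + 2) * exp (- pi * y\<^sup>2 + (pi - 1) * y)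
     + 2 / (1 - exp (- 2 * pi * b)) * exp (- pi * y\<^sup>2 + (3 * pi) * y))" (is "integrable _ ?f")
    by (intro Bochner_Integration.integrable_add integrable_mult_right integrable_exp_quadratic) auto
  also have "?f = saddle_majorant b"
    unfolding saddle_majorant_def distrib_left distrib_right mult.assoc exp_add[symmetric]
    by (simp add: algebra_simps)
  finally show ?thesis .
qed

lemma abs_le_exp_sum: "\<bar>y\<bar> \<le> exp y + exp (- y :: real)" "\<bar>y\<bar> ^ 3 \<le> 27 * (exp y + exp (- y))"
proof -
  have e: "exp \<bar>y\<bar> \<le> exp y + exp (- y)" by (auto simp: abs_if)
  show "\<bar>y\<bar> \<le> exp y + exp (- y :: real)"
    using exp_ge_add_one_self[of "\<bar>y\<bar>"] e by linarith
  have "\<bar>y\<bar> / 3 \<le> exp (\<bar>y\<bar> / 3)" using exp_ge_add_one_self[of "\<bar>y\<bar> / 3"] by linarith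
  then have "(\<bar>y\<bar> / 3) ^ 3 \<le> exp (\<bar>y\<bar> / 3) ^ 3" by (intro power_mono) auto
  also have "exp (\<bar>y\<bar> / 3) ^ 3 = exp \<bar>y\<bar>" by (simp flip: exp_of_nat_mult)
  finally show "\<bar>y\<bar> ^ 3 \<le> 27 * (exp y + exp (- y))" using e by (simp add: power_divide)
qed

text \<open>Write \<open>1 / (1 - q) = 1 + q / (1 - q)\<close>. The error then consists of the
  change of exponent, an exponentially small correction from \<open>q\<close>, and the part of the
  full Gaussian beyond the end of the ray.\<close>

lemma norm_saddle_error_le:
  assumes a: "a > 0" "2 * b \<le> a" and b: "b > 0"
  shows "norm ((if y < a - b then exp (saddle_exponent a y) / (1 - exp (- (2 * of_real pi * \<i> * diag_point a (a - y)))) else 0)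
     - exp (gauss_exponent y)) \<le> saddle_majorant b y / a"
proof -
  define g where "g = exp (- pi * y\<^sup>2 + pi * y)"
  define \<delta> where "\<delta> = 1 - exp (- 2 * pi * b)"
  define S where "S = exp y + exp (- y)"
  have g: "g > 0" by (simp add: g_def)
  have S: "S > 0" by (simp add: S_def add_pos_pos)
  have \<delta>: "\<delta> > 0" using b by (simp add: \<delta>_def)
  have saddle_majorant: "saddle_majorant b y / a = ((432 * pi + 2) * S * g + 2 / \<delta> * exp (2 * pi * y) * g) / a"
    unfolding saddle_majorant_def g_def \<delta>_def S_def by (simp add: algebra_simps)
  have eB: "norm (exp (gauss_exponent y)) \<le> g"
    unfolding g_def norm_exp_eq_Re Re_gauss_exponent by simp
  show ?thesis
  proof (cases "y < a - b")
    case True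
    then have ya: "y < a" using b by simp
    define A where "A = saddle_exponent a y"
    define B where "B = gauss_exponent y"
    define q where "q = exp (- (2 * of_real pi * \<i> * diag_point a (a - y)))"
    have nq: "norm q = exp (- (2 * pi * (a - y)))"
      unfolding q_def by (simp add: norm_exp_eq_Re algebra_simps)
    have "norm q \<le> exp (- 2 * pi * b)" unfolding nq using True by simp
    then have q1: "\<delta> \<le> norm (1 - q)"
      unfolding \<delta>_def using norm_triangle_ineq2[of 1 q] by simp
    have "exp (1 / 2 :: real) \<le> 2"
    proof -
      have "exp (1 / 2 :: real) ^ 2 = exp 1" by (simp flip: exp_of_nat_mult)
      also have "\<dots> \<le> 2 ^ 2" using exp_le by simp
      finally show ?thesis by (rule power2_le_imp_le) simp
    qed
    moreover have "exp (Re A) \<le> g * exp (1 / 2)"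
      unfolding g_def exp_add[symmetric] A_def using Re_saddle_exponent_le[OF a(1) ya] by simp
    ultimately have eA: "exp (Re A) \<le> 2 * g"
      using mult_left_mono[of "exp (1 / 2)" 2 g] g by linarith
    have "exp (max (Re A) (Re B)) \<le> 2 * g"
      using eA eB g by (auto simp: max_def B_def norm_exp_eq_Re)
    then have 1: "norm (exp A - exp B) \<le> 2 * g * ((8 * pi * \<bar>y\<bar> ^ 3 + \<bar>y\<bar>) / a)"
      using norm_saddle_minus_gauss_le[OF a(1) ya] g unfolding A_def B_def
      by (intro order_trans[OF norm_exp_diff_le] mult_mono) auto
    have 2: "8 * pi * \<bar>y\<bar> ^ 3 + \<bar>y\<bar> \<le> 8 * pi * (27 * S) + S"
      unfolding S_def using abs_le_exp_sum[of y] by (intro add_mono mult_left_mono) auto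
    have "2 * g * ((8 * pi * \<bar>y\<bar> ^ 3 + \<bar>y\<bar>) / a) \<le> 2 * g * ((8 * pi * (27 * S) + S) / a)"
      using 2 g a by (intro mult_left_mono divide_right_mono) auto
    with 1 have 1: "norm (exp A - exp B) \<le> (432 * pi + 2) * S * g / a"
      by (simp add: algebra_simps)
    have "norm (exp A * q / (1 - q)) = exp (Re A) * exp (- (2 * pi * (a - y))) / norm (1 - q)"
      by (simp add: norm_mult norm_divide nq norm_exp_eq_Re)
    also have "\<dots> \<le> 2 * g * exp (- (2 * pi * (a - y))) / \<delta>"
      using eA q1 \<delta> g by (intro frac_le mult_right_mono) auto
    also have "exp (- (2 * pi * (a - y))) = exp (2 * pi * y) * exp (- (2 * pi * a))"
      by (simp add: algebra_simps flip: exp_add)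
    also have "2 * g * (exp (2 * pi * y) * exp (- (2 * pi * a))) / \<delta> \<le> 2 * g * (exp (2 * pi * y) * (1 / a)) / \<delta>"
    proof -
      \<comment> \<open>The exponentially small factor is weakened to \<open>1 / a\<close>, the
        order of the other errors.\<close>
      have "a \<le> exp (2 * pi * a)"
        using exp_ge_add_one_self[of "2 * pi * a"] mult_right_mono[of 1 "2 * pi" a] pi_ge_two a by linarith
      then have "exp (- (2 * pi * a)) \<le> 1 / a" using a by (simp add: exp_minus field_simps)
      then show ?thesis using g \<delta> by (intro divide_right_mono mult_left_mono) auto
    qed
    finally have 3: "norm (exp A * q / (1 - q)) \<le> 2 / \<delta> * exp (2 * pi * y) * g / a"
      by (simp add: field_simps)
    have "1 - q \<noteq> 0" using q1 \<delta> by auto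
    then have "exp A / (1 - q) - exp B = (exp A - exp B) + exp A * q / (1 - q)"
      by (simp add: field_simps)
    then have "norm (exp A / (1 - q) - exp B) \<le> norm (exp A - exp B) + norm (exp A * q / (1 - q))"
      by (metis norm_triangle_ineq)
    with 1 3 have "norm (exp A / (1 - q) - exp B) \<le> saddle_majorant b y / a"
      unfolding saddle_majorant add_divide_distrib by linarith
    then show ?thesis using True by (simp add: A_def B_def q_def)
  next
    case False
    \<comment> \<open>Beyond the ray only the Gaussian is left. There
      \<open>y \<ge> a - b \<ge> a / 2\<close>, so a factor \<open>2 * \<bar>y\<bar> / a\<close> may
      be inserted.\<close>
    have "a \<le> 2 * \<bar>y\<bar>" using False a(2) by linarith
    then have "1 \<le> 2 * \<bar>y\<bar> / a" using a by simp
    also have "\<dots> \<le> 2 * S / a"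
      using abs_le_exp_sum(1)[of y] a unfolding S_def by (intro divide_right_mono mult_left_mono) auto
    finally have "g * 1 \<le> g * (2 * S / a)" using g by (intro mult_left_mono) auto
    also have "\<dots> = 2 * S * g / a" by simp
    also have "\<dots> \<le> saddle_majorant b y / a"
    proof -
      have "2 * S * g \<le> (432 * pi + 2) * S * g" using S g by (intro mult_right_mono) auto
      then show ?thesis unfolding saddle_majorant using g \<delta> a by (intro divide_right_mono add_increasing2) auto
    qed
    finally show ?thesis using False eB by simp
  qed
qed

text \<open>Substitute \<open>r = a - y\<close>, extend by zero to the real line, and integrate the
  pointwise error. The comparison Gaussian has integral
  \<open>exp (- (\<i> * pi / 8)) / 2\<close>.\<close>

lemma norm_saddle_integral_le:
  assumes a: "a > 0" "2 * b \<le> a" and b: "b > 0"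
  shows "norm ((LBINT r:{b<..}. crit_integrand (2 * pi * a\<^sup>2) (diag_point a r)) - exp (saddle_value a) * (exp (- (\<i> * of_real pi / 8)) / 2))
    \<le> norm (exp (saddle_value a)) * ((LBINT y. saddle_majorant b y) / a)"
proof -
  define f where "f y = (if y < a - b then exp (saddle_exponent a y) / (1 - exp (- (2 * of_real pi * \<i> * diag_point a (a - y)))) else 0)" for y
  let ?G = "\<lambda>r. indicat_real {b<..} r *\<^sub>R crit_integrand (2 * pi * a\<^sup>2) (diag_point a r)"
  have G: "?G (a + - 1 * y) = exp (saddle_value a) * f y" for y
    using crit_integrand_saddle[OF a(1), of y] b by (auto simp: f_def indicator_def)
  have "integrable lborel (\<lambda>y. ?G (a + - 1 * y))"
    using set_integrable_crit_integrand_ray[OF b] unfolding set_integrable_def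
    by (subst lborel_integrable_real_affine_iff) auto
  then have "integrable lborel (\<lambda>y. exp (- saddle_value a) * (exp (saddle_value a) * f y))"
    unfolding G by (rule integrable_mult_right)
  then have f: "integrable lborel f"
    by (simp flip: mult.assoc exp_add)
  have e: "integrable lborel (\<lambda>y. exp (gauss_exponent y))"
    using integrable_cexp_quadratic[of "4 * pi"] unfolding gauss_exponent_def by simp
  have "(LBINT y. exp (gauss_exponent y)) = of_real (sqrt (pi / (4 * pi))) * exp ((of_real pi * (1 - \<i>))\<^sup>2 / (4 * of_real (4 * pi)))"
    unfolding gauss_exponent_def by (rule integral_cexp_quadratic) simp
  also have "sqrt (pi / (4 * pi)) = 1 / 2"
    by (simp add: real_sqrt_divide)
  also have "(of_real pi * (1 - \<i>))\<^sup>2 / (4 * of_real (4 * pi)) = - (\<i> * of_real pi / 8)"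
    by (simp add: power2_eq_square field_simps)
  finally have eI: "(LBINT y. exp (gauss_exponent y)) = exp (- (\<i> * of_real pi / 8)) / 2" by simp
  have "(LBINT r:{b<..}. crit_integrand (2 * pi * a\<^sup>2) (diag_point a r)) = \<bar>- 1\<bar> *\<^sub>R (LBINT y. ?G (a + - 1 * y))"
    unfolding set_lebesgue_integral_def by (rule lborel_integral_real_affine) simp
  also have "\<dots> = exp (saddle_value a) * (LBINT y. f y)" unfolding G by simp
  finally have "(LBINT r:{b<..}. crit_integrand (2 * pi * a\<^sup>2) (diag_point a r)) - exp (saddle_value a) * (exp (- (\<i> * of_real pi / 8)) / 2)
     = exp (saddle_value a) * (LBINT y. f y - exp (gauss_exponent y))"
    using f e by (simp add: eI right_diff_distrib)
  moreover have "norm (LBINT y. f y - exp (gauss_exponent y)) \<le> (LBINT y. saddle_majorant b y / a)"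
    using f e integrable_saddle_majorant norm_saddle_error_le[OF a b] unfolding f_def
    by (intro Bochner_Integration.integral_norm_bound_integral) auto
  ultimately show ?thesis
    by (simp only: norm_mult integral_divide_zero mult_left_mono norm_ge_zero)
qed

text \<open>The phase \<open>3 * pi / 8\<close> is \<open>pi / 4\<close> from the direction
  \<open>1 + \<i>\<close>, plus \<open>pi / 4\<close> from \<open>x powr (-1/2)\<close> at the
  saddle, minus \<open>pi / 8\<close> from the Gaussian integral.\<close>

lemma main_term_eq:
  assumes t: "t > 0" and a: "a = sqrt (t / (2 * pi))"
  shows "- complex_of_real (1 / sqrt 2 * (t / (2 * pi)) powr (-1/4) * exp (pi * t / 2 - (pi * t / 2) powr (1/2)))
        * exp (\<i> * complex_of_real (t / 2 * ln (t / (2 * pi)) - t / 2 + 3 * pi / 8))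
     = - (1 + \<i>) * (exp (saddle_value a) * (exp (- (\<i> * of_real pi / 8)) / 2))"
proof -
  have a0: "a > 0" using t a by simp
  have ta: "t = 2 * pi * a\<^sup>2" using t by (simp add: a)
  have 1: "ln (t / (2 * pi)) = 2 * ln a" using a0 by (simp add: ta ln_realpow)
  have 2: "(t / (2 * pi)) powr (-1/4) = exp (- ln a / 2)"
    using t 1 by (simp add: powr_def)
  have "pi * t / 2 = (pi * a)\<^sup>2" by (simp add: ta power2_eq_square)
  then have "(pi * t / 2) powr (1/2) = sqrt ((pi * a)\<^sup>2)"
    using t by (simp only: powr_half_sqrt zero_le_power2)
  then have 3: "(pi * t / 2) powr (1/2) = pi * a" using a0 by simp
  have 4: "1 + \<i> = of_real (sqrt 2) * exp (\<i> * of_real pi / 4)"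
    by (simp add: complex_eq_iff Re_exp Im_exp cos_45 sin_45)
  have 5: "complex_of_real (1 / sqrt 2) = of_real (sqrt 2) / 2"
    by (simp add: field_simps flip: of_real_mult)
  have "- complex_of_real (1 / sqrt 2 * (t / (2 * pi)) powr (-1/4) * exp (pi * t / 2 - (pi * t / 2) powr (1/2)))
        * exp (\<i> * complex_of_real (t / 2 * ln (t / (2 * pi)) - t / 2 + 3 * pi / 8))
    = - (of_real (sqrt 2) / 2) * exp (of_real (- ln a / 2) + of_real (pi * t / 2 - pi * a) + \<i> * complex_of_real (t / 2 * (2 * ln a) - t / 2 + 3 * pi / 8))"
    unfolding 1 2 3 of_real_mult 5 exp_add exp_of_real by simp
  also have "of_real (- ln a / 2) + of_real (pi * t / 2 - pi * a) + \<i> * complex_of_real (t / 2 * (2 * ln a) - t / 2 + 3 * pi / 8)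
    = \<i> * of_real pi / 4 + saddle_value a + (- (\<i> * of_real pi / 8))"
    unfolding saddle_value_def ta by (simp add: complex_eq_iff power2_eq_square)
  also have "- (of_real (sqrt 2) / 2) * exp (\<i> * of_real pi / 4 + saddle_value a + (- (\<i> * of_real pi / 8)))
    = - (1 + \<i>) * (exp (saddle_value a) * (exp (- (\<i> * of_real pi / 8)) / 2))"
    unfolding 4 exp_add by simp
  finally show ?thesis .
qed

section \<open>The asymptotic formula\<close>

lemma norm_exp_saddle_value:
  "a > 0 \<Longrightarrow> norm (exp (saddle_value a)) = exp (- ln a / 2 + pi\<^sup>2 * a\<^sup>2 - pi * a)"
  unfolding norm_exp_eq_Re saddle_value_def by simp

text \<open>The integral is \<open>U + V + S + T\<close>: the part above the cut, the cost of the
  shift, the saddle error and the main term. The first two are of size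
  \<open>exp (pi * t / 4)\<close> up to \<open>exp (O(a))\<close>, against
  \<open>exp (pi * t / 2 - pi * a)\<close> and a power of \<open>a\<close> in
  \<open>T\<close>.\<close>

lemma norm_relative_error_le:
  assumes c: "0 < c" "c < 1" and a: "a \<ge> 1"
  shows "norm (riemann_aux c (1/2 - \<i> * of_real (2 * pi * a\<^sup>2)) / (- (1 + \<i>) * (exp (saddle_value a) * (exp (- (\<i> * of_real pi / 8)) / 2))) - 1)
    \<le> 2 * exp (ln a / 2 - pi\<^sup>2 * a\<^sup>2 / 2 + pi * a) *
       ((LBINT r. norm (crit_integrand 0 (diag_point c r))) + (c/2) powr (-1/2) / (1 - exp (- pi * c)) * exp (pi * a) * a)
      + 2 * (LBINT y. saddle_majorant (c/2) y) / a"
proof -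
  define t where "t = 2 * pi * a\<^sup>2"
  define b where "b = c / 2"
  define T where "T = exp (saddle_value a) * (exp (- (\<i> * of_real pi / 8)) / 2)"
  define U where "U = (LBINT r:{..b}. crit_integrand t (diag_point c r))"
  define V where "V = (LBINT r:{b<..}. crit_integrand t (diag_point c r)) - (LBINT r:{b<..}. crit_integrand t (diag_point a r))"
  define S where "S = (LBINT r:{b<..}. crit_integrand t (diag_point a r)) - T"
  define N where "N = norm (exp (saddle_value a))"
  have b: "b > 0" using c by (simp add: b_def)
  have t: "t \<ge> 0" by (simp add: t_def)
  have N: "N > 0" by (simp add: N_def)
  have NT: "norm T = N / 2" by (simp add: T_def N_def norm_mult norm_divide norm_exp_eq_Re)
  then have T0: "T \<noteq> 0" using N by auto
  have "(LBINT r. crit_integrand t (diag_point c r)) = (LBINT r:{..b} \<union> {b<..}. crit_integrand t (diag_point c r))"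
  proof -
    have "{..b} \<union> {b<..} = UNIV" by auto
    then show ?thesis by (simp add: set_lebesgue_integral_def)
  qed
  also have "\<dots> = U + (LBINT r:{b<..}. crit_integrand t (diag_point c r))" unfolding U_def
    using integrable_crit_integrand[OF c, of t]
    by (intro set_integral_Un) (auto simp: set_integrable_def intro!: integrable_mult_indicator)
  finally have "riemann_aux c (1/2 - \<i> * of_real t) = - (1 + \<i>) * (U + V + S + T)"
    unfolding riemann_aux_eq by (simp add: U_def V_def S_def)
  moreover have "1 + \<i> \<noteq> 0" by (simp add: complex_eq_iff)
  ultimately have "riemann_aux c (1/2 - \<i> * of_real t) / (- (1 + \<i>) * T) - 1 = (U + V + S) / T"
    using T0 by (simp only: mult_divide_mult_cancel_left neg_equal_0_iff_equal not_False_eq_True) (simp add: field_simps)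
  also have "norm \<dots> = 2 / N * norm (U + V + S)"
    by (simp add: norm_divide NT)
  also have "\<dots> \<le> 2 / N * ((exp (pi * t / 4) * (LBINT r. norm (crit_integrand 0 (diag_point c r))) +
     exp (pi * t / 4) * (b powr (-1/2) / (1 - exp (- pi * c)) * exp (pi * a) * a)) + N * ((LBINT y. saddle_majorant b y) / a))"
  proof (intro mult_left_mono order_trans[OF norm_triangle_ineq] add_mono)
    show "norm U \<le> exp (pi * t / 4) * (LBINT r. norm (crit_integrand 0 (diag_point c r)))"
      unfolding U_def b_def using norm_integral_upper_le[OF c t] .
    have "norm V \<le> b powr (-1/2) / (1 - exp (- 2 * pi * b)) * exp (pi * t / 4) * exp (2 * pi * (a - b) * b) * (a - c)"
      unfolding V_def using c a t b by (intro norm_integral_shift_le) (auto simp: b_def)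
    also have "\<dots> \<le> b powr (-1/2) / (1 - exp (- 2 * pi * b)) * exp (pi * t / 4) * exp (pi * a) * a"
    proof -
      \<comment> \<open>Since \<open>2 * b = c < 1\<close>, the growth on the horizontal segment is
        at most \<open>exp (pi * a)\<close>.\<close>
      have "(a - b) * (2 * b) \<le> a * 1" using a b c by (intro mult_mono) (auto simp: b_def)
      then have "pi * ((a - b) * (2 * b)) \<le> pi * (a * 1)" by (intro mult_left_mono) auto
      then show ?thesis using a b c by (intro mult_mono mult_left_mono) (auto simp: algebra_simps)
    qed
    finally show "norm V \<le> exp (pi * t / 4) * (b powr (-1/2) / (1 - exp (- pi * c)) * exp (pi * a) * a)"
      by (simp add: b_def mult_ac)
    show "norm S \<le> N * ((LBINT y. saddle_majorant b y) / a)"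
      unfolding S_def T_def N_def t_def using a b c by (intro norm_saddle_integral_le) (auto simp: b_def)
  qed (use N in auto)
  also have "\<dots> = 2 * (exp (pi * t / 4) / N) * ((LBINT r. norm (crit_integrand 0 (diag_point c r))) + b powr (-1/2) / (1 - exp (- pi * c)) * exp (pi * a) * a)
      + 2 * (LBINT y. saddle_majorant b y) / a"
    using N by (simp add: field_simps)
  also have "exp (pi * t / 4) / N = exp (ln a / 2 - pi\<^sup>2 * a\<^sup>2 / 2 + pi * a)"
  proof -
    have "N = exp (- ln a / 2 + pi\<^sup>2 * a\<^sup>2 - pi * a)"
      unfolding N_def using a by (intro norm_exp_saddle_value) simp
    then show ?thesis
      by (simp add: t_def power2_eq_square flip: exp_diff)
  qed
  finally show ?thesis unfolding T_def t_def b_def .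
qed

theorem corollary18:
  fixes c :: real
  assumes "0 < c" and "c < 1"
  shows "\<exists>E \<in> O[at_top](\<lambda>t::real. complex_of_real (t powr (-1/2))).
    \<forall>\<^sub>F t in at_top.
      riemann_aux c (1/2 - \<i> * complex_of_real t) =
        - complex_of_real (1 / sqrt 2 * (t / (2 * pi)) powr (-1/4)
             * exp (pi * t / 2 - (pi * t / 2) powr (1/2)))
        * exp (\<i> * complex_of_real (t / 2 * ln (t / (2 * pi)) - t / 2 + 3 * pi / 8))
        * (1 + E t)"
proof -
  define T where "T t = - complex_of_real (1 / sqrt 2 * (t / (2 * pi)) powr (-1/4)
             * exp (pi * t / 2 - (pi * t / 2) powr (1/2)))
        * exp (\<i> * complex_of_real (t / 2 * ln (t / (2 * pi)) - t / 2 + 3 * pi / 8))" for t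
  \<comment> \<open>With \<open>E\<close> defined as the relative error, the identity holds wherever
    \<open>T t\<close> is nonzero, and only the size of \<open>E\<close> is at stake.\<close>
  define E where "E t = riemann_aux c (1/2 - \<i> * complex_of_real t) / T t - 1" for t
  define C1 where "C1 = (LBINT r. norm (crit_integrand 0 (diag_point c r)))"
  define C2 where "C2 = (c/2) powr (-1/2) / (1 - exp (- pi * c))"
  define C3 where "C3 = (LBINT y. saddle_majorant (c/2) y)"
  define B where "B a = 2 * exp (ln a / 2 - pi\<^sup>2 * a\<^sup>2 / 2 + pi * a) * (C1 + C2 * exp (pi * a) * a) + 2 * C3 / a" for a
  \<comment> \<open>The factor \<open>exp (- pi\<^sup>2 * a\<^sup>2 / 2)\<close> beats every
    \<open>exp (O(a))\<close>, so the saddle error \<open>2 * C3 / a\<close> determines the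
    order.\<close>
  have B: "B \<in> O[at_top](\<lambda>a. 1 / a)"
    unfolding B_def by real_asymp
  have lim: "filterlim (\<lambda>t::real. sqrt (t / (2 * pi))) at_top at_top"
    by real_asymp
  have "(\<lambda>t. B (sqrt (t / (2 * pi)))) \<in> O[at_top](\<lambda>t. 1 / sqrt (t / (2 * pi)))"
    using landau_o.big.compose[OF B lim] .
  also have "(\<lambda>t. 1 / sqrt (t / (2 * pi))) \<in> O[at_top](\<lambda>t::real. t powr (-1/2))"
    by real_asymp
  finally have BO: "(\<lambda>t. B (sqrt (t / (2 * pi)))) \<in> O[at_top](\<lambda>t. t powr (-1/2))" .
  have T0: "T t \<noteq> 0" if "t > 0" for t
    using that by (simp add: T_def)
  \<comment> \<open>The condition \<open>t \<ge> 2 * pi\<close> amounts to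
    \<open>a \<ge> 1\<close>.\<close>
  have le: "norm (E t) \<le> B (sqrt (t / (2 * pi)))" if t: "t \<ge> 2 * pi" for t
  proof -
    define a where "a = sqrt (t / (2 * pi))"
    have t0: "t > 0" using t pi_gt_zero by linarith
    have a: "a \<ge> 1" using t by (simp add: a_def)
    have ta: "t = 2 * pi * a\<^sup>2" using t0 by (simp add: a_def)
    have T_eq: "T t = - (1 + \<i>) * (exp (saddle_value a) * (exp (- (\<i> * of_real pi / 8)) / 2))"
      unfolding T_def by (rule main_term_eq[OF t0 a_def])
    have "norm (E t) \<le> B a"
      unfolding E_def T_eq B_def C1_def C2_def C3_def
      using norm_relative_error_le[OF assms a] unfolding ta[symmetric] .
    then show ?thesis by (simp add: a_def)
  qed
  obtain K where "eventually (\<lambda>t. norm (B (sqrt (t / (2 * pi)))) \<le> K * norm (t powr (-1/2))) at_top"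
    using landau_o.bigE[OF BO] by blast
  then have "eventually (\<lambda>t. norm (E t) \<le> K * norm (complex_of_real (t powr (-1/2)))) at_top"
    using eventually_ge_at_top[of "2 * pi"]
  proof eventually_elim
    case (elim t)
    then show ?case using le[of t] by simp
  qed
  then have "E \<in> O[at_top](\<lambda>t::real. complex_of_real (t powr (-1/2)))" by (rule bigoI)
  moreover have "\<forall>\<^sub>F t in at_top. riemann_aux c (1/2 - \<i> * complex_of_real t) = T t * (1 + E t)"
    using eventually_gt_at_top[of 0] by eventually_elim (use T0 in \<open>simp add: E_def\<close>)
  ultimately show ?thesis unfolding T_def by blast
qed

end
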